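(* For each integer $b\ge 4$ there exist infinitely many valid digit sets $\mathcal{D}$ for the base $b$ with $0\in\mathcal{D}$, and infinitely many valid digit sets $\mathcal{D}$ for the base $b$ with $0\notin\mathcal{D}$.
   Context: For an integer $b$ with $|b|\ge 2$, a digit set is a set $\mathcal{D}\subset\mathbb{Z}$ with exactly $|b|$ elements containing exactly one element of each residue class modulo $b$. It is valid for $b$ if every $a\in\mathbb{Z}$ can be written as $a=\sum_{i=0}^{\ell-1}d_ib^i$ with $\ell\ge 1$ and all $d_i\in\mathcal{D}$. *)

theory Defs
  imports "HOL-Number_Theory.Cong"
begin

definition digit_set :: "int \<Rightarrow> int set \<Rightarrow> bool" where
  "digit_set b D \<longleftrightarrow>
     \<bar>b\<bar> \<ge> 2 \<and> finite D \<and> int (card D) = \<bar>b\<bar> \<and> (\<forall>a. \<exists>!d. d \<in> D \<and> [d = a] (mod b))"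

definition valid_digit_set :: "int \<Rightarrow> int set \<Rightarrow> bool" where
  "valid_digit_set b D \<longleftrightarrow>
     digit_set b D \<and>
     (\<forall>a. \<exists>(l::nat) (d :: nat \<Rightarrow> int).
        l \<ge> 1 \<and> (\<forall>i<l. d i \<in> D) \<and> a = (\<Sum>i<l. d i * b ^ i))"

end

theory Submission
  imports Defs
begin

text \<open>
  Start from the valid digit set \<open>{-1, 0, \<dots>, b - 2}\<close>. Replace the digit \<open>1\<close> by \<open>1 + b ^ n\<close> and
  either keep \<open>0\<close> or replace it by \<open>b\<close>. In computing an expansion, the new digit \<open>1 + b ^ n\<close> emits
  a carry \<open>-1\<close> with delay \<open>n\<close>, and the digit \<open>b\<close> emits an immediate carry \<open>-1\<close>. Once the original
  digits of the input are used up, every column is a sum of a delayed and an immediate carry, hence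
  lies in \<open>{-2, -1, 0}\<close>. For \<open>b \<ge> 4\<close> none of these is congruent to \<open>1\<close>, so no further
  delayed carry is emitted and the process reaches \<open>0\<close>.
\<close>

section \<open>Expansions built digit by digit, and complete residue systems\<close>

definition representable :: "int \<Rightarrow> int set \<Rightarrow> int \<Rightarrow> bool" where
  "representable b D a \<longleftrightarrow>
     (\<exists>(l::nat) (d :: nat \<Rightarrow> int). l \<ge> 1 \<and> (\<forall>i<l. d i \<in> D) \<and> a = (\<Sum>i<l. d i * b ^ i))"

lemma representable_digit:
  assumes "x \<in> D"
  shows "representable b D x"
  unfolding representable_def
  by (rule exI[of _ 1], rule exI[of _ "\<lambda>_. x"]) (use assms in simp)

lemma representable_step:
  assumes "x \<in> D" and "representable b D y"
  shows "representable b D (x + b * y)"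
proof -
  obtain l d where l: "l \<ge> (1::nat)" "\<forall>i<l. d i \<in> D" "y = (\<Sum>i<l. d i * b ^ i)"
    using assms(2) unfolding representable_def by blast
  define e where "e = case_nat x d"
  have "(\<Sum>i<Suc l. e i * b ^ i) = x + b * y"
    unfolding sum.lessThan_Suc_shift l(3)
    by (simp add: e_def sum_distrib_left mult_ac)
  moreover have "\<forall>i<Suc l. e i \<in> D"
    using l(2) assms(1) by (auto simp: e_def split: nat.split)
  ultimately show ?thesis
    unfolding representable_def by (intro exI[of _ "Suc l"] exI[of _ e]) auto
qed

text \<open>The interval \<open>{-1..b - 2}\<close> is a complete residue system, and moving each
  member within its own residue class keeps it one.\<close>

lemma digit_set_image:
  fixes b :: int
  assumes "b \<ge> 2" and "\<And>r. [f r = r] (mod b)"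
  shows "digit_set b (f ` {-1..b - 2})"
proof -
  have inj: "r = s" if "r \<in> {-1..b - 2}" "s \<in> {-1..b - 2}" "[f r = f s] (mod b)" for r s
  proof -
    have "[r = s] (mod b)"
      using that(3) assms(2) by (meson cong_sym cong_trans)
    then have "(r + 1) mod b = (s + 1) mod b"
      by (metis cong_add_rcancel cong_def)
    then show ?thesis
      using that(1,2) by simp
  qed
  have "inj_on f {-1..b - 2}"
    by (rule inj_onI) (use inj in auto)
  then have "card (f ` {-1..b - 2}) = nat b"
    by (simp add: card_image)
  moreover have "\<exists>!d. d \<in> f ` {-1..b - 2} \<and> [d = a] (mod b)" for a
  proof -
    define r where "r = (a + 1) mod b - 1"
    have "-1 \<le> r" "r \<le> b - 2"
      using assms(1) pos_mod_bound[of b "a + 1"] pos_mod_sign[of b "a + 1"]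
      unfolding r_def by linarith+
    then have r: "r \<in> {-1..b - 2}" by simp
    have "[(a + 1) mod b - 1 = (a + 1) - 1] (mod b)"
      by (intro cong_diff) (auto simp: cong_def)
    then have "[r = a] (mod b)"
      by (simp add: r_def)
    then have fr: "[f r = a] (mod b)"
      using assms(2) cong_trans by blast
    show ?thesis
    proof (rule ex1I)
      show "f r \<in> f ` {-1..b - 2} \<and> [f r = a] (mod b)"
        using r fr by simp
    next
      fix y
      assume y: "y \<in> f ` {-1..b - 2} \<and> [y = a] (mod b)"
      then obtain s where s: "s \<in> {-1..b - 2}" "y = f s" by blast
      then have "[f s = f r] (mod b)"
        using y fr cong_sym cong_trans by blast
      then show "y = f r"
        using inj[OF s(1) r] s(2) by simp
    qed
  qed
  ultimately show ?thesis
    using assms(1) unfolding digit_set_def by simp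
qed

section \<open>The queue of delayed carries and the modified digit sets\<close>

text \<open>Negatives of numbers with \<open>j\<close> base-\<open>b\<close> digits in
  \<open>{0, 1}\<close>. They encode a queue: the coefficient at \<open>b ^ i\<close> is the carry
  due \<open>i\<close> columns ahead.\<close>

primrec pending_carries :: "int \<Rightarrow> nat \<Rightarrow> int set" where
  "pending_carries b 0 = {0}"
| "pending_carries b (Suc j) = {b * t - e | t e. t \<in> pending_carries b j \<and> e \<in> {0, 1}}"

lemma pending_carries_0: "0 \<in> pending_carries b j"
  by (induction j) force+

text \<open>The recursion peels off the lowest position, where a carry falls due; a newly emitted
  carry enters at the top.\<close>

lemma pending_carries_append:
  assumes "t \<in> pending_carries b j" and "e \<in> {0, 1}"
  shows "t - e * b ^ j \<in> pending_carries b (Suc j)"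
  using assms(1)
proof (induction j arbitrary: t)
  case 0
  then show ?case using assms(2) by auto
next
  case (Suc j)
  then obtain s f where s: "t = b * s - f" "s \<in> pending_carries b j" "f \<in> {0, 1}"
    by auto
  have "t - e * b ^ Suc j = b * (s - e * b ^ j) - f"
    by (simp add: s algebra_simps)
  then show ?case
    using Suc.IH[OF s(2)] s(3) pending_carries.simps(2)[of b "Suc j"] by blast
qed

text \<open>The parameter \<open>z\<close> serves both halves of the theorem: \<open>z = 0\<close>
  keeps the digit zero, \<open>z = b\<close> replaces it within its residue class.\<close>

definition shifted_digit :: "int \<Rightarrow> nat \<Rightarrow> int \<Rightarrow> int \<Rightarrow> int" where
  "shifted_digit b n z r = (if r = 0 then z else if r = 1 then 1 + b ^ n else r)"

definition shifted_digits :: "int \<Rightarrow> nat \<Rightarrow> int \<Rightarrow> int set" where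
  "shifted_digits b n z = shifted_digit b n z ` {-1..b - 2}"

lemma shifted_digitsI:
  assumes "b \<ge> 4"
  shows "-1 \<in> shifted_digits b n z" "z \<in> shifted_digits b n z"
    "1 + b ^ n \<in> shifted_digits b n z"
    "2 \<le> r \<Longrightarrow> r \<le> b - 2 \<Longrightarrow> r \<in> shifted_digits b n z"
proof -
  have "shifted_digit b n z r \<in> shifted_digits b n z" if "-1 \<le> r" "r \<le> b - 2" for r
    using that by (auto simp: shifted_digits_def)
  from this[of "-1"] this[of 0] this[of 1] this[of r] assms
  show "-1 \<in> shifted_digits b n z" "z \<in> shifted_digits b n z"
    "1 + b ^ n \<in> shifted_digits b n z"
    "2 \<le> r \<Longrightarrow> r \<le> b - 2 \<Longrightarrow> r \<in> shifted_digits b n z"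
    by (auto simp: shifted_digit_def)
qed

text \<open>Here \<open>c\<close> is the immediate carry. The current column is
  \<open>-(e + c)\<close>, so the digits \<open>z\<close>, \<open>-1\<close> and
  \<open>b - 2\<close> suffice, and each step shortens the queue.\<close>

lemma representable_pending_carries:
  assumes "b \<ge> 4" and "z \<in> {0, b}" and "t \<in> pending_carries b j" and "c \<in> {0, 1}"
  shows "representable b (shifted_digits b n z) (t - c)"
  using assms(3,4)
proof (induction j arbitrary: t c)
  let ?R = "representable b (shifted_digits b n z)"
  note D = shifted_digitsI[OF assms(1), where n = n and z = z]
  case 0
  have m1: "?R (-1)"
    by (rule representable_digit) (rule D)
  have "?R 0"
  proof (cases "z = 0")
    case True
    then show ?thesis using representable_digit D(2) by metis
  next
    case False
    \<comment> \<open>For \<open>z = b\<close>, zero is written as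
      \<open>b + b * (-1)\<close>.\<close>
    then show ?thesis
      using representable_step[OF D(2) m1] assms(2) by simp
  qed
  with m1 show ?case using 0 by auto
next
  let ?R = "representable b (shifted_digits b n z)"
  note D = shifted_digitsI[OF assms(1), where n = n and z = z]
  case (Suc j)
  then obtain s e where s: "t = b * s - e" "s \<in> pending_carries b j" "e \<in> {0, 1}"
    by auto
  have IH: "?R s" "?R (s - 1)"
    using Suc.IH[OF s(2), of 0] Suc.IH[OF s(2), of 1] by auto
  consider "e + c = 0" "z = 0" | "e + c = 0" "z = b" | "e + c = 1" | "e + c = 2"
    using s(3) Suc.prems(2) assms(2) by auto
  then show ?case
  proof cases
    case 1
    then have "t - c = z + b * s" by (simp add: s)
    then show ?thesis using representable_step[OF D(2) IH(1)] by simp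
  next
    case 2
    then have "t - c = z + b * (s - 1)" by (simp add: s algebra_simps)
    then show ?thesis using representable_step[OF D(2) IH(2)] by simp
  next
    case 3
    then have "t - c = -1 + b * s" by (simp add: s)
    then show ?thesis using representable_step[OF D(1) IH(1)] by simp
  next
    case 4
    then have "t - c = (b - 2) + b * (s - 1)" by (simp add: s algebra_simps)
    then show ?thesis
      using representable_step[OF D(4)[of "b - 2"] IH(2)] assms(1) by simp
  qed
qed

text \<open>Each step strips one column from the input \<open>u\<close> and from the queue
  \<open>t\<close>. One carry leaves the queue and a possibly zero one enters, so its length stays
  \<open>Suc m\<close> while \<open>u\<close> shrinks.\<close>

lemma representable_input_plus_carries:
  assumes "b \<ge> 4" and "z \<in> {0, b}" and "t \<in> pending_carries b (Suc m)" and "c \<in> {0, 1}"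
  shows "representable b (shifted_digits b (Suc m) z) (u + t - c)"
  using assms(3,4)
proof (induction "nat \<bar>u\<bar>" arbitrary: u t c rule: less_induct)
  case less
  let ?R = "representable b (shifted_digits b (Suc m) z)"
  note D = shifted_digitsI[OF assms(1), where n = "Suc m" and z = z]
  show ?case
  proof (cases "u = 0")
    case True
    then show ?thesis
      using representable_pending_carries[OF assms(1,2) less.prems] by simp
  next
    case False
    \<comment> \<open>With remainders in \<open>{-1..b - 2}\<close>, \<open>u = -1\<close> has
      quotient \<open>0\<close>; the usual remainder would give quotient \<open>-1\<close> again and
      no descent.\<close>
    define w d where "w = (u + 1) div b" and "d = (u + 1) mod b - 1"
    have u: "u = d + b * w"
      using mult_div_mod_eq[of b "u + 1"] unfolding w_def d_def by linarith
    have d: "-1 \<le> d" "d \<le> b - 2"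
      using assms(1) pos_mod_bound[of b "u + 1"] pos_mod_sign[of b "u + 1"]
      unfolding d_def by linarith+
    have "\<bar>w\<bar> < \<bar>u\<bar>"
    proof (cases "w \<ge> 0")
      case True
      then have "4 * w \<le> b * w" using assms(1) by (simp add: mult_right_mono)
      then show ?thesis using True u d False by linarith
    next
      case neg: False
      then have "b * w \<le> 4 * w + 4 - b"
        using mult_right_mono_neg[of 4 b "w + 1"] assms(1) by (simp add: algebra_simps)
      then have "u \<le> 4 * w + 2" using u d(2) by linarith
      then show ?thesis using neg by linarith
    qed
    then have smaller: "nat \<bar>w\<bar> < nat \<bar>u\<bar>" by simp
    obtain s e where s: "t = b * s - e" "s \<in> pending_carries b m" "e \<in> {0, 1}"
      using less.prems(1) by auto
    \<comment> \<open>Removing the due carry frees the top slot, position \<open>m\<close>; it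
      receives either nothing or a new delayed carry.\<close>
    have "s \<in> pending_carries b (Suc m)" "s - b ^ m \<in> pending_carries b (Suc m)"
      using pending_carries_append[OF s(2), of 0] pending_carries_append[OF s(2), of 1]
      by auto
    from less.hyps[OF smaller this(1), of 0] less.hyps[OF smaller this(1), of 1]
      less.hyps[OF smaller this(2), of 0] less.hyps[OF smaller this(2), of 1]
    have IH: "?R (w + s)" "?R (w + s - 1)" "?R (w + (s - b ^ m))" "?R (w + (s - b ^ m) - 1)"
      by auto
    define v where "v = d - e - c"
    have x: "u + t - c = v + b * (w + s)"
      by (simp add: u s v_def algebra_simps)
    have "-3 \<le> v" "v \<le> b - 2"
      using d s(3) less.prems(2) unfolding v_def by auto
    \<comment> \<open>The value \<open>-3\<close> is split because it is congruent to
      \<open>1\<close> when \<open>b = 4\<close>, whereas for \<open>b > 4\<close> the digit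
      \<open>b - 3\<close> is at least \<open>2\<close>.\<close>
    then have "v = 0 \<or> v = -1 \<or> v = 1 \<or> 2 \<le> v \<and> v \<le> b - 2
        \<or> v = -2 \<or> v = -3 \<and> b > 4 \<or> v = -3 \<and> b = 4"
      using assms(1) by presburger
    then consider "v = 0" "z = 0" | "v = 0" "z = b" | "v = -1" | "v = 1" | "2 \<le> v" "v \<le> b - 2"
      | "v = -2 \<or> v = -3 \<and> b > 4" | "v = -3" "b = 4"
      using assms(2) by blast
    then show ?thesis
    proof cases
      case 1
      then show ?thesis using x representable_step[OF D(2) IH(1)] by simp
    next
      case 2
      then have "u + t - c = z + b * (w + s - 1)" unfolding x by (simp add: algebra_simps)
      then show ?thesis using representable_step[OF D(2) IH(2)] by simp
    next
      case 3
      then show ?thesis using x representable_step[OF D(1) IH(1)] by simp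
    next
      case 4
      \<comment> \<open>The excess \<open>b ^ Suc m\<close> of the digit is repaid as
        \<open>b ^ m\<close> after division by \<open>b\<close>.\<close>
      then have "u + t - c = (1 + b ^ Suc m) + b * (w + (s - b ^ m))"
        unfolding x by (simp add: algebra_simps)
      then show ?thesis using representable_step[OF D(3) IH(3)] by simp
    next
      case 5
      then show ?thesis using x representable_step[OF D(4)[OF 5] IH(1)] by simp
    next
      case 6
      then have "2 \<le> b + v" "b + v \<le> b - 2" using assms(1) by auto
      moreover have "u + t - c = (b + v) + b * (w + s - 1)"
        unfolding x by (simp add: algebra_simps)
      ultimately show ?thesis using representable_step[OF D(4) IH(2)] by simp
    next
      case 7
      \<comment> \<open>Since \<open>v - 1 = -b\<close>, an immediate carry accompanies the delayed
        one.\<close>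
      then have "u + t - c = (1 + b ^ Suc m) + b * (w + (s - b ^ m) - 1)"
        unfolding x by (simp add: algebra_simps)
      then show ?thesis using representable_step[OF D(3) IH(4)] by simp
    qed
  qed
qed

lemma valid_shifted_digits:
  assumes "b \<ge> 4" and "z \<in> {0, b}"
  shows "valid_digit_set b (shifted_digits b (Suc m) z)"
proof -
  \<comment> \<open>The positive exponent \<open>Suc m\<close> makes \<open>1 + b ^ Suc m\<close>
    congruent to \<open>1\<close>.\<close>
  have "digit_set b (shifted_digits b (Suc m) z)"
    unfolding shifted_digits_def
    by (rule digit_set_image) (use assms in \<open>auto simp: shifted_digit_def cong_def\<close>)
  moreover have "representable b (shifted_digits b (Suc m) z) a" for a
    using representable_input_plus_carries[OF assms pending_carries_0, of 0 m a] by simp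
  ultimately show ?thesis
    by (auto simp: valid_digit_set_def representable_def)
qed

text \<open>The digit \<open>1 + b ^ Suc m\<close> exceeds \<open>b\<close>, hence every digit other
  than \<open>1 + b ^ Suc k\<close> in the second set; so the two powers agree.\<close>

lemma inj_shifted_digits:
  assumes "b \<ge> 4" and "z \<in> {0, b}"
  shows "inj (\<lambda>m. shifted_digits b (Suc m) z)"
proof (rule injI)
  fix m k
  assume "shifted_digits b (Suc m) z = shifted_digits b (Suc k) z"
  then have "1 + b ^ Suc m \<in> shifted_digits b (Suc k) z"
    using shifted_digitsI(3)[OF assms(1)] by metis
  then obtain r where r: "r \<le> b - 2" "1 + b ^ Suc m = shifted_digit b (Suc k) z r"
    by (auto simp: shifted_digits_def)
  have "b ^ Suc m \<ge> b ^ 1"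
    using assms(1) by (intro power_increasing) auto
  then have "b ^ Suc m \<ge> b" by simp
  then have "b ^ Suc m = b ^ Suc k"
    using r assms by (auto simp: shifted_digit_def simp del: power_Suc split: if_splits)
  then show "m = k"
    using assms(1) power_inject_exp[of b "Suc m" "Suc k"] by simp
qed

lemma zero_in_shifted_digits_iff:
  assumes "b \<ge> 4"
  shows "0 \<in> shifted_digits b n z \<longleftrightarrow> z = 0"
proof
  \<comment> \<open>Positivity of \<open>1 + b ^ n\<close> leaves \<open>z\<close> as the only digit
    that can vanish.\<close>
  have "b ^ n > 0" using assms by simp
  then show "z = 0" if "0 \<in> shifted_digits b n z"
    using that by (auto simp: shifted_digits_def shifted_digit_def split: if_splits)
qed (use shifted_digitsI(2)[OF assms] in metis)

theorem corollary3p8: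
  fixes b :: int
  assumes "b \<ge> 4"
  shows "infinite {D. valid_digit_set b D \<and> 0 \<in> D} \<and>
         infinite {D. valid_digit_set b D \<and> 0 \<notin> D}"
proof
  have inf: "infinite (range (\<lambda>m. shifted_digits b (Suc m) z))" if "z \<in> {0, b}" for z
    using inj_shifted_digits[OF assms that] using finite_imageD infinite_UNIV_nat by blast
  show "infinite {D. valid_digit_set b D \<and> 0 \<in> D}"
    by (rule infinite_super[OF _ inf[of 0]])
      (use assms valid_shifted_digits zero_in_shifted_digits_iff in auto)
  show "infinite {D. valid_digit_set b D \<and> 0 \<notin> D}"
    by (rule infinite_super[OF _ inf[of b]])
      (use assms valid_shifted_digits zero_in_shifted_digits_iff in auto)
qed

end
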